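(* Let $a_0=1$ and, for $n\ge 1$, let $a_n=|\mathcal{S}_n(31;\,2\to 2)|$. Then for every $n\ge 1$, $$a_n = d_n + \sum_{m=1}^{n} d_{n-m}\, a_{m-1},$$ where $d_j$ denotes the $j$-th derangement number.
   Context: $[n]=\{1,\dots,n\}$, and $\mathcal{S}_n$ is the set of permutations $\pi=\pi_1\pi_2\cdots\pi_n$ of $[n]$ in one-line notation. The permutation $\hat\pi$: for $\pi\in\mathcal{S}_n$, $\hat\pi\in\mathcal{S}_n$ is the permutation whose cycle form is obtained from the word $\pi_1\cdots\pi_n$ by inserting a left parenthesis before each left-to-right maximum (an entry larger than all entries to its left) and a right parenthesis immediately before the next left-to-right maximum, or at the end of the word. A cycle $(c_1,c_2,\dots,c_s)$ means $c_1\mapsto c_2\mapsto\cdots\mapsto c_s\mapsto c_1$. Example: if $\pi=2537164$ then $\hat\pi=(2)(53)(7164)$. Arrow patterns: an arrow pattern of size $k$ is a pair $(\nu;H)$ where $\nu=\nu_1\cdots\nu_m$ is a word of distinct positive integers, $H$ is a collection of arrows $b_i\to c_i$, and the set of all integers appearing in $\nu$ or $H$ is $[k]$. A permutation $\pi\in\mathcal{S}_n$ contains $(\nu;H)$ if there are a set $X=\{x_1<x_2<\cdots<x_k\}\subseteq[n]$ and indices $t_1<\cdots<t_m$ such that $\pi_{t_1}\pi_{t_2}\cdots\pi_{t_m}=x_{\nu_1}x_{\nu_2}\cdots x_{\nu_m}$ and $\hat\pi(x_{b_i})=x_{c_i}$ for every arrow $b_i\to c_i$ in $H$. Otherwise $\pi$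 avoids $(\nu;H)$. $\mathcal{S}_n(\nu;H)$ is the set of permutations in $\mathcal{S}_n$ avoiding $(\nu;H)$. The derangement number $d_j$ is the number of permutations of $[j]$ without fixed points ($d_0=1$, $d_1=0$). *)

theory Defs
  imports "HOL-Combinatorics.Combinatorics"
begin

text \<open>
  A permutation of \<open>{1..n}\<close> in one-line notation is a word
  \<open>w \<in> permutations_of_set {1..n}\<close>; positions in the word are counted from 0, so that
  \<open>w ! t\<close> is the entry usually written \<open>\<pi>\<close> with index \<open>t + 1\<close>.
\<close>

definition ltr_max_positions :: "nat list \<Rightarrow> nat list" where
  "ltr_max_positions w = filter (\<lambda>i. \<forall>j<i. w ! j < w ! i) [0..<length w]"

text \<open>
  The parenthesised blocks: each one runs from a left-to-right maximum up to just before the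
  next one, the last block running up to the end of the word.
\<close>

definition cycle_words :: "nat list \<Rightarrow> nat list list" where
  "cycle_words w = map2 (\<lambda>i j. nths w {i..<j})
     (ltr_max_positions w) (tl (ltr_max_positions w) @ [length w])"

text \<open>
  \<^const>\<open>cycle_of_list\<close> sends every entry of a list to its successor and the last entry to the
  first. The blocks of a word with distinct entries are disjoint, so the order of composition
  is irrelevant.
\<close>

definition hat :: "nat list \<Rightarrow> nat \<Rightarrow> nat" where
  "hat w = foldr (\<circ>) (map cycle_of_list (cycle_words w)) id"

text \<open>
  An arrow pattern consists of a word \<open>\<nu>\<close> and a set \<open>H\<close> of arrows, where \<open>(b, c) \<in> H\<close> stands for
  the arrow from \<open>b\<close> to \<open>c\<close>.
\<close>

definition pattern_letters :: "nat list \<Rightarrow> (nat \<times> nat) set \<Rightarrow> nat set" where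
  "pattern_letters \<nu> H = set \<nu> \<union> fst ` H \<union> snd ` H"

definition pattern_size :: "nat list \<Rightarrow> (nat \<times> nat) set \<Rightarrow> nat" where
  "pattern_size \<nu> H = card (pattern_letters \<nu> H)"

definition is_arrow_pattern :: "nat list \<Rightarrow> (nat \<times> nat) set \<Rightarrow> bool" where
  "is_arrow_pattern \<nu> H \<longleftrightarrow>
     distinct \<nu> \<and> pattern_letters \<nu> H = {1..pattern_size \<nu> H}"

text \<open>
  The set \<open>X\<close> of the chosen values is given by its increasing enumeration \<open>x 1 < \<dots> < x k\<close>.
\<close>

definition contains_arrow_pattern ::
    "nat list \<Rightarrow> nat list \<Rightarrow> (nat \<times> nat) set \<Rightarrow> bool" where
  "contains_arrow_pattern w \<nu> H \<longleftrightarrow>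
     (\<exists>(x :: nat \<Rightarrow> nat) (t :: nat \<Rightarrow> nat).
        strict_mono_on {1..pattern_size \<nu> H} x \<and>
        x ` {1..pattern_size \<nu> H} \<subseteq> {1..length w} \<and>
        strict_mono_on {..<length \<nu>} t \<and>
        t ` {..<length \<nu>} \<subseteq> {..<length w} \<and>
        (\<forall>i<length \<nu>. w ! t i = x (\<nu> ! i)) \<and>
        (\<forall>(b, c)\<in>H. hat w (x b) = x c))"

definition avoiders :: "nat \<Rightarrow> nat list \<Rightarrow> (nat \<times> nat) set \<Rightarrow> nat list set" where
  "avoiders n \<nu> H = {w \<in> permutations_of_set {1..n}. \<not> contains_arrow_pattern w \<nu> H}"

definition derangement_number :: "nat \<Rightarrow> nat" where
  "derangement_number j = card {p. p permutes {1..j} \<and> (\<forall>i\<in>{1..j}. p i \<noteq> i)}"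

lemma is_arrow_pattern_31_22: "is_arrow_pattern [3, 1] {(2, 2)}"
  by (auto simp: is_arrow_pattern_def pattern_size_def pattern_letters_def)

lemma cycle_words_example: "cycle_words [2, 5, 3, 7, 1, 6, 4] = [[2], [5, 3], [7, 1, 6, 4]]"
  by code_simp

lemma hat_example: "map (hat [2, 5, 3, 7, 1, 6, 4]) [1..<8] = [6, 2, 5, 7, 3, 4, 1]"
  unfolding hat_def cycle_words_example by code_simp

end

theory Submission
  imports Defs
begin

text \<open>
  A fixed point \<open>b\<close> of \<open>hat w\<close> is a left-to-right maximum that is immediately followed by the next
  one or by the end of the word. Hence everything before \<open>b\<close> is smaller, and if something smaller
  than \<open>b\<close> came after it, then it would form the pattern with the entry right after \<open>b\<close>. So \<open>w\<close>
  avoids the pattern iff every fixed point \<open>b\<close> of \<open>hat w\<close> has only smaller entries before it and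
  only larger ones after it. Cutting an avoider at the largest fixed point \<open>m\<close> leaves an
  avoider of size \<open>m - 1\<close> and a word on \<open>{m<..n}\<close> whose image under \<open>hat\<close> is a derangement. As
  \<open>hat\<close> is a bijection from words to permutations, there are \<open>d\<^sub>n\<^sub>-\<^sub>m\<close> of the latter; the
  avoiders without a fixed point give the term \<open>d\<^sub>n\<close>.
\<close>

section \<open>Left-to-right maxima, blocks and \<open>hat\<close> of a concatenation\<close>

text \<open>A left-to-right maximum of \<open>v\<close> is at least \<open>hd v\<close>, so it
  exceeds all of \<open>u\<close> anyway and prefixing \<open>u\<close> only shifts its position.
  The premise is conditional because \<open>hd []\<close> is unspecified.\<close>

lemma ltr_max_positions_append:
  assumes "v \<noteq> [] \<Longrightarrow> \<forall>x\<in>set u. x < hd v"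
  shows "ltr_max_positions (u @ v) = ltr_max_positions u @ map ((+) (length u)) (ltr_max_positions v)"
proof -
  have "[0..<length (u @ v)] = [0..<length u] @ map ((+) (length u)) [0..<length v]"
    by (rule nth_equalityI) (auto simp: nth_append)
  moreover have "filter (\<lambda>i. \<forall>j<i. (u @ v) ! j < (u @ v) ! i) [0..<length u] = ltr_max_positions u"
    unfolding ltr_max_positions_def by (rule filter_cong) (auto simp: nth_append)
  moreover have "(\<forall>j<length u + i. (u @ v) ! j < (u @ v) ! (length u + i)) \<longleftrightarrow> (\<forall>j<i. v ! j < v ! i)"
    if "i < length v" for i
  proof
    assume *: "\<forall>j<length u + i. (u @ v) ! j < (u @ v) ! (length u + i)"
    show "\<forall>j<i. v ! j < v ! i"
    proof (intro allI impI)
      fix j assume "j < i"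
      with *[rule_format, of "length u + j"] show "v ! j < v ! i" by simp
    qed
  next
    assume *: "\<forall>j<i. v ! j < v ! i"
    have "v \<noteq> []" using that by auto
    show "\<forall>j<length u + i. (u @ v) ! j < (u @ v) ! (length u + i)"
    proof (intro allI impI)
      fix j assume j: "j < length u + i"
      show "(u @ v) ! j < (u @ v) ! (length u + i)"
      proof (cases "j < length u")
        case True
        then have "u ! j < v ! 0"
          using assms[OF \<open>v \<noteq> []\<close>] \<open>v \<noteq> []\<close> by (simp add: hd_conv_nth)
        also have "v ! 0 \<le> v ! i" using * by (cases i) (auto intro: less_imp_le)
        finally show ?thesis using True by (simp add: nth_append)
      next
        case False
        with * j show ?thesis by (simp add: nth_append)
      qed
    qed
  qed
  then have "filter (\<lambda>i. \<forall>j<length u + i. (u @ v) ! j < (u @ v) ! (length u + i)) [0..<length v]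
      = ltr_max_positions v"
    unfolding ltr_max_positions_def by (intro filter_cong) auto
  ultimately show ?thesis
    unfolding ltr_max_positions_def[of "u @ v"] by (simp add: filter_map o_def)
qed

lemma ltr_max_positions_Cons:
  "\<exists>ps. ltr_max_positions (x # v) = 0 # ps"
proof -
  have "[0..<length (x # v)] = 0 # map Suc [0..<length v]"
    by (simp add: map_Suc_upt upt_conv_Cons del: upt_Suc)
  then show ?thesis unfolding ltr_max_positions_def by simp
qed

lemma ltr_max_positions_less_length: "i \<in> set (ltr_max_positions w) \<Longrightarrow> i < length w"
  by (auto simp: ltr_max_positions_def)

text \<open>The first letter of \<open>v\<close> opens a new block, so the last block of
  \<open>u\<close> stops at \<open>length u\<close>, exactly as it does when \<open>u\<close> stands
  alone.\<close>

lemma cycle_words_append: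
  assumes "v \<noteq> [] \<Longrightarrow> \<forall>x\<in>set u. x < hd v"
  shows "cycle_words (u @ v) = cycle_words u @ cycle_words v"
proof (cases "v = []")
  case True
  then show ?thesis by (simp add: cycle_words_def ltr_max_positions_def)
next
  case False
  let ?n = "length u"
  let ?P = "ltr_max_positions u" and ?Q = "ltr_max_positions v"
  obtain qs where qs: "?Q = 0 # qs"
    using False ltr_max_positions_Cons by (cases v) auto
  \<comment> \<open>The start \<open>0\<close> of the first block of \<open>v\<close>, shifted by
    \<open>?n\<close>, becomes the end of the last block of \<open>u\<close>. If \<open>u\<close> is
    empty there is no such block, hence the case distinction.\<close>
  have tl: "tl (ltr_max_positions (u @ v)) @ [length (u @ v)]
      = (tl ?P @ (if ?P = [] then [] else [?n])) @ map ((+) ?n) (tl ?Q @ [length v])"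
    using ltr_max_positions_append[OF assms] qs by (cases ?P) auto
  have P: "length ?P = length (tl ?P @ (if ?P = [] then [] else [?n]))" by auto
  have A: "map2 (\<lambda>i j. nths (u @ v) {i..<j}) ?P (tl ?P @ (if ?P = [] then [] else [?n]))
      = cycle_words u"
  proof -
    have *: "nths (u @ v) {i..<j} = nths u {i..<j}" if "j \<le> ?n" for i j
      using that by (auto simp: nths_append)
    show ?thesis
    proof (cases ?P)
      case Nil
      then show ?thesis by (simp add: cycle_words_def)
    next
      case (Cons p ps)
      then have "j \<le> ?n" if "j \<in> set (ps @ [?n])" for j
        using that ltr_max_positions_less_length[of j u] by auto
      then show ?thesis unfolding cycle_words_def using Cons
        by (auto intro!: map_cong * dest: set_zip_rightD)
    qed
  qed
  have B: "map2 (\<lambda>i j. nths (u @ v) {i..<j}) (map ((+) ?n) ?Q) (map ((+) ?n) (tl ?Q @ [length v]))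
      = cycle_words v"
  proof -
    have "nths (u @ v) {?n + i..<?n + j} = nths v {i..<j}" for i j
    proof -
      have "nths u {?n + i..<?n + j} = []"
        by (auto simp: nths_def filter_empty_conv dest: set_zip_rightD)
      moreover have "{k. k + ?n \<in> {?n + i..<?n + j}} = {i..<j}" by auto
      ultimately show ?thesis by (simp add: nths_append)
    qed
    then show ?thesis unfolding cycle_words_def zip_map_map by (simp add: case_prod_beta o_def)
  qed
  let ?f = "\<lambda>i j. nths (u @ v) {i..<j}"
  have "ltr_max_positions (u @ v) = ?P @ map ((+) ?n) ?Q"
    by (rule ltr_max_positions_append) (use assms in simp)
  then have "cycle_words (u @ v) = map2 ?f (?P @ map ((+) ?n) ?Q)
      ((tl ?P @ (if ?P = [] then [] else [?n])) @ map ((+) ?n) (tl ?Q @ [length v]))"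
    unfolding cycle_words_def[of "u @ v"] tl by (rule arg_cong)
  also have "\<dots> = map2 ?f ?P (tl ?P @ (if ?P = [] then [] else [?n]))
      @ map2 ?f (map ((+) ?n) ?Q) (map ((+) ?n) (tl ?Q @ [length v]))"
    by (subst zip_append[OF P]) (rule map_append)
  also have "\<dots> = cycle_words u @ cycle_words v"
    by (rule arg_cong2[OF A B])
  finally show ?thesis .
qed

lemma foldr_comp_append: "foldr (\<circ>) (fs @ gs) id = foldr (\<circ>) fs id \<circ> foldr (\<circ>) gs id"
  by (induction fs) (simp_all add: comp_assoc del: foldr_append)

text \<open>Serves twice: to split off the block of the largest entry, and to cut a word around a
  fixed point.\<close>

lemma hat_append:
  assumes "v \<noteq> [] \<Longrightarrow> \<forall>x\<in>set u. x < hd v"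
  shows "hat (u @ v) = hat u \<circ> hat v"
proof -
  have "cycle_words (u @ v) = cycle_words u @ cycle_words v"
    by (rule cycle_words_append) (use assms in simp)
  then show ?thesis unfolding hat_def by (simp only: map_append foldr_comp_append)
qed

lemma hat_Nil [simp]: "hat [] = id"
  by (simp add: hat_def cycle_words_def ltr_max_positions_def)

lemma hat_block:
  assumes "\<forall>y\<in>set v. y < M"
  shows "hat (M # v) = cycle_of_list (M # v)"
proof -
  have "\<not> (\<forall>j<i. (M # v) ! j < (M # v) ! i)" if "0 < i" "i < length (M # v)" for i
  proof -
    have "(M # v) ! i \<in> set v" using that by (cases i) auto
    then have "\<not> (M # v) ! 0 < (M # v) ! i" using assms by auto
    then show ?thesis using that(1) by blast
  qed
  moreover have "[0..<length (M # v)] = 0 # [Suc 0..<length (M # v)]"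
    by (subst upt_conv_Cons) (simp_all del: upt_Suc)
  ultimately have "ltr_max_positions (M # v) = [0]"
    unfolding ltr_max_positions_def by (simp add: filter_empty_conv del: nth_Cons_Suc upt_Suc)
  then show ?thesis by (simp add: hat_def cycle_words_def nths_all)
qed

lemma hat_singleton [simp]: "hat [x] = id"
  using hat_block[of "[]" x] by simp

text \<open>The largest entry is the last left-to-right maximum, so its block ends the word.
  Removing this block drives the inductions on the length of the word.\<close>

lemma last_block_decomp:
  assumes "w \<noteq> []" "distinct w"
  obtains u v where "w = u @ Max (set w) # v" "\<forall>x\<in>set u. x < Max (set w)"
    "\<forall>x\<in>set v. x < Max (set w)" "hat w = hat u \<circ> cycle_of_list (Max (set w) # v)"
proof -
  let ?M = "Max (set w)"
  have "?M \<in> set w" using assms by simp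
  then obtain u v where w: "w = u @ ?M # v" by (meson split_list)
  have "x < ?M" if "x \<in> set u \<union> set v" for x
  proof -
    have "?M \<notin> set u \<union> set v" using assms(2) by (subst (asm) w) auto
    moreover have "x \<in> set w" using that by (subst w) auto
    ultimately show ?thesis using that Max_ge[of "set w" x] by (metis List.finite_set order_less_le)
  qed
  then have u: "\<forall>x\<in>set u. x < ?M" and v: "\<forall>x\<in>set v. x < ?M" by auto
  have "hat w = hat (u @ ?M # v)" using w by simp
  also have "\<dots> = hat u \<circ> cycle_of_list (?M # v)"
    using u by (simp add: hat_append hat_block[OF v])
  finally show ?thesis using that w u v by blast
qed

section \<open>\<open>hat\<close> as a bijection from words to permutations\<close>

lemma hat_permutes:
  assumes "distinct w"
  shows "hat w permutes set w"
  using assms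
proof (induction w rule: length_induct)
  case (1 w)
  show ?case
  proof (cases "w = []")
    case False
    obtain u v where w: "w = u @ Max (set w) # v" and h: "hat w = hat u \<circ> cycle_of_list (Max (set w) # v)"
      using last_block_decomp[OF False "1.prems"] by metis
    have "length u < length w" by (subst w) simp
    moreover have "distinct u" using w "1.prems" by (metis distinct_append)
    ultimately have "hat u permutes set u" using "1.IH" by blast
    then have "hat u permutes set w" by (rule permutes_subset) (use w in \<open>metis Un_upper1 set_append\<close>)
    moreover have "cycle_of_list (Max (set w) # v) permutes set w"
      by (rule permutes_subset[OF cycle_permutes]) (use w in \<open>metis Un_upper2 set_append\<close>)
    ultimately show ?thesis unfolding h by (rule permutes_compose[rotated])
  qed (simp add: fun_eq_iff)
qed

text \<open>Iterating \<open>f\<close> from \<open>c\<close> reads the list cyclically, because the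
  orbit never leaves the list, where \<open>f\<close> agrees with the cycle.\<close>

lemma funpow_eq_nth_cycle:
  assumes "distinct (c # cs)" "\<And>x. x \<in> set (c # cs) \<Longrightarrow> f x = cycle_of_list (c # cs) x"
  shows "(f ^^ i) c = (c # cs) ! (i mod length (c # cs))"
proof -
  let ?C = "cycle_of_list (c # cs)"
  have "(f ^^ i) c = (?C ^^ i) c \<and> (?C ^^ i) c \<in> set (c # cs)"
  proof (induction i)
    case (Suc i)
    have "?C ((?C ^^ i) c) \<in> set (c # cs)"
      using Suc cycle_permutes permutes_in_image by metis
    then show ?case using Suc assms(2) by simp
  qed simp
  \<comment> \<open>Written as the head of a mapped list, the iterate falls under
    \<open>cyclic_rotation\<close>, which turns that list into a rotation.\<close>
  also have "(?C ^^ i) c = map (?C ^^ i) (c # cs) ! 0" by simp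
  finally show ?thesis
    unfolding cyclic_rotation[OF assms(1)] by (simp add: nth_rotate)
qed

text \<open>The orbit of \<open>c\<close> under \<open>f\<close> lists the letters in order and its
  first return to \<open>c\<close> gives the length, so \<open>f\<close> and the first letter
  determine the cycle word.\<close>

lemma cycle_unique:
  assumes "distinct (c # cs)" "distinct (c # ds)"
    "\<And>x. x \<in> set (c # cs) \<Longrightarrow> f x = cycle_of_list (c # cs) x"
    "\<And>x. x \<in> set (c # ds) \<Longrightarrow> f x = cycle_of_list (c # ds) x"
  shows "cs = ds"
proof -
  have le: "length (c # ds) \<le> length (c # cs)"
    if *: "distinct (c # cs)" "distinct (c # ds)"
      "\<And>x. x \<in> set (c # cs) \<Longrightarrow> f x = cycle_of_list (c # cs) x"
      "\<And>x. x \<in> set (c # ds) \<Longrightarrow> f x = cycle_of_list (c # ds) x" for cs ds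
  proof (rule ccontr)
    let ?n = "length (c # cs)"
    assume "\<not> ?thesis"
    then have n: "?n < length (c # ds)" by simp
    \<comment> \<open>After \<open>?n\<close> steps the orbit is back at \<open>c\<close>, so a
      longer \<open>c # ds\<close> would repeat its first letter.\<close>
    have "(c # ds) ! ?n = (f ^^ ?n) c"
      using funpow_eq_nth_cycle[OF *(2,4), of ?n] n by simp
    also have "\<dots> = (c # ds) ! 0"
      using funpow_eq_nth_cycle[OF *(1,3), of ?n] by simp
    finally show False using *(2) n nth_eq_iff_index_eq by fastforce
  qed
  have len: "length (c # cs) = length (c # ds)"
    by (rule antisym) (rule le; fact assms)+
  have "c # cs = c # ds"
  proof (rule nth_equalityI[OF len])
    fix i assume "i < length (c # cs)"
    then show "(c # cs) ! i = (c # ds) ! i"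
      using funpow_eq_nth_cycle[OF assms(1,3), of i] funpow_eq_nth_cycle[OF assms(2,4), of i] len
      by simp
  qed
  then show ?thesis by simp
qed

text \<open>The cycle keeps its own letters among themselves, and \<open>hat u\<close> fixes all of
  these.\<close>

lemma hat_eq_cycle_of_list:
  assumes "distinct (u @ c # v)" "hat w = hat u \<circ> cycle_of_list (c # v)" "x \<in> set (c # v)"
  shows "hat w x = cycle_of_list (c # v) x"
proof -
  have "cycle_of_list (c # v) x \<in> set (c # v)"
    using assms(3) permutes_in_image[OF cycle_permutes] by metis
  then have "cycle_of_list (c # v) x \<notin> set u" using assms(1) by auto
  moreover have "hat u permutes set u" using assms(1) by (intro hat_permutes) simp
  ultimately show ?thesis using assms(2) by (simp add: permutes_not_in)
qed

text \<open>The last block of either word is the cycle of the common map through the maximum,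
  written from the maximum, so the last blocks agree. Cancelling this cycle leaves the shorter
  prefixes for the induction.\<close>

lemma hat_inj:
  assumes "distinct w" "distinct w'" "set w = set w'" "hat w = hat w'"
  shows "w = w'"
  using assms
proof (induction w arbitrary: w' rule: length_induct)
  case (1 w)
  show ?case
  proof (cases "w = []")
    case False
    let ?M = "Max (set w)"
    have "w' \<noteq> []" using False "1.prems"(3) by auto
    obtain u v where w: "w = u @ ?M # v" and h: "hat w = hat u \<circ> cycle_of_list (?M # v)"
      using last_block_decomp[OF False "1.prems"(1)] by metis
    obtain u' v' where w': "w' = u' @ ?M # v'" and h': "hat w' = hat u' \<circ> cycle_of_list (?M # v')"
      using last_block_decomp[OF \<open>w' \<noteq> []\<close> "1.prems"(2)] "1.prems"(3) by metis
    have d: "distinct (u @ ?M # v)" "distinct (u' @ ?M # v')"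
      using w w' "1.prems"(1,2) by simp_all
    have v: "v = v'"
    proof (rule cycle_unique[where f = "hat w"])
      show "distinct (?M # v)" "distinct (?M # v')" using d by auto
      show "hat w x = cycle_of_list (?M # v) x" if "x \<in> set (?M # v)" for x
        using hat_eq_cycle_of_list[OF d(1) h that] .
      show "hat w x = cycle_of_list (?M # v') x" if "x \<in> set (?M # v')" for x
        using hat_eq_cycle_of_list[OF d(2) h' that] "1.prems"(4) by simp
    qed
    have "hat u \<circ> cycle_of_list (?M # v) = hat u' \<circ> cycle_of_list (?M # v)"
      using "1.prems"(4) unfolding h h' v .
    \<comment> \<open>Surjectivity permits cancelling the common cycle on the right.\<close>
    moreover have "surj (cycle_of_list (?M # v))"
      using cycle_permutes by (rule permutes_surj)
    ultimately have "hat u = hat u'" by (metis fun.map_comp comp_id surj_iff)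
    moreover have "set u = set u'"
    proof -
      have "set u \<union> set (?M # v) = set u' \<union> set (?M # v)"
        using "1.prems"(3) w w' v by (metis set_append)
      moreover have "set u \<inter> set (?M # v) = {}" "set u' \<inter> set (?M # v) = {}" using d v by auto
      ultimately show ?thesis by blast
    qed
    moreover have "length u < length w" by (subst w) simp
    moreover have "distinct u" "distinct u'" using d by auto
    ultimately have "u = u'" using "1.IH" by blast
    then show ?thesis using w w' v by metis
  qed (use "1.prems" in simp)
qed

text \<open>Surjectivity comes from counting: words and permutations are equinumerous, so no inverse
  of \<open>hat\<close> is constructed.\<close>

lemma hat_bij_betw:
  assumes "finite A"
  shows "bij_betw hat (permutations_of_set A) {p. p permutes A}"
proof -
  have inj: "inj_on hat (permutations_of_set A)"
    by (rule inj_onI) (auto simp: permutations_of_set_def intro: hat_inj)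
  have sub: "hat ` permutations_of_set A \<subseteq> {p. p permutes A}"
    using hat_permutes by (auto simp: permutations_of_set_def)
  have "hat ` permutations_of_set A = {p. p permutes A}"
  proof (rule card_subset_eq[OF _ sub])
    show "finite {p. p permutes A}" using finite_permutations[OF assms] .
    show "card (hat ` permutations_of_set A) = card {p. p permutes A}"
      using assms by (simp add: card_image[OF inj] card_permutations)
  qed
  with inj show ?thesis by (simp add: bij_betw_def)
qed

section \<open>Counting derangements on arbitrary finite sets\<close>

text \<open>Needed because the values above a fixed point \<open>m\<close> form
  \<open>{m<..n}\<close> rather than an initial interval. Conjugation with a bijection between the
  sets preserves having no fixed point.\<close>

lemma card_derangements:
  assumes "finite A"
  shows "card {p. p permutes A \<and> (\<forall>i\<in>A. p i \<noteq> i)} = derangement_number (card A)"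
proof -
  obtain f where f: "bij_betw f A {1..card A}"
    using finite_same_card_bij[OF assms, of "{1..card A}"] by auto
  \<comment> \<open>The conjugate of \<open>p\<close> by \<open>f\<close>, extended by the identity,
    in the shape used by \<open>bij_betw_permutations\<close>.\<close>
  let ?F = "\<lambda>p x. if x \<in> {1..card A} then f (p (inv_into A f x)) else x"
  have "bij_betw ?F {p. p permutes A \<and> (\<forall>i\<in>A. p i \<noteq> i)}
      {p. p permutes {1..card A} \<and> (\<forall>i\<in>{1..card A}. p i \<noteq> i)}"
  proof -
    have iff: "(\<forall>i\<in>A. p i \<noteq> i) \<longleftrightarrow> (\<forall>i\<in>{1..card A}. ?F p i \<noteq> i)" if p: "p permutes A" for p
    proof -
      have "?F p (f i) = f i \<longleftrightarrow> p i = i" if "i \<in> A" for i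
      proof -
        have "f i \<in> {1..card A}" "inv_into A f (f i) = i" "p i \<in> A"
          using f that p by (auto simp: bij_betw_def permutes_in_image)
        then show ?thesis using f that by (auto simp: bij_betw_def inj_on_eq_iff)
      qed
      moreover have "{1..card A} = f ` A" using f by (simp add: bij_betw_def)
      ultimately show ?thesis by (metis (no_types, lifting) imageE image_eqI)
    qed
    show ?thesis
      using bij_betw_Collect[OF bij_betw_permutations[OF f], where P = "\<lambda>p. \<forall>i\<in>A. p i \<noteq> i"
          and Q = "\<lambda>p. \<forall>i\<in>{1..card A}. p i \<noteq> i"] iff
      by simp
  qed
  then show ?thesis unfolding derangement_number_def by (rule bij_betw_same_card)
qed

definition hat_derangements :: "nat set \<Rightarrow> nat list set" where
  "hat_derangements A = {w \<in> permutations_of_set A. \<forall>i\<in>A. hat w i \<noteq> i}"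

lemma card_hat_derangements:
  assumes "finite A"
  shows "card (hat_derangements A) = derangement_number (card A)"
proof -
  have "bij_betw hat (hat_derangements A) {p. p permutes A \<and> (\<forall>i\<in>A. p i \<noteq> i)}"
    using bij_betw_Collect[OF hat_bij_betw[OF assms], where P = "\<lambda>w. \<forall>i\<in>A. hat w i \<noteq> i"
        and Q = "\<lambda>p. \<forall>i\<in>A. p i \<noteq> i"]
    by (simp add: hat_derangements_def)
  then show ?thesis using card_derangements[OF assms] by (simp add: bij_betw_same_card)
qed

section \<open>Fixed points of \<open>hat\<close>\<close>

text \<open>Each letter goes to the next position modulo the length, which is a different position
  once the length is at least two; the form \<open>c # d # cs\<close> ensures that.\<close>

lemma cycle_of_list_no_fixed_point:
  assumes "distinct (c # d # cs)" "x \<in> set (c # d # cs)"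
  shows "cycle_of_list (c # d # cs) x \<noteq> x"
proof
  let ?l = "c # d # cs"
  assume eq: "cycle_of_list ?l x = x"
  obtain i where i: "i < length ?l" "x = ?l ! i" using assms(2) by (metis in_set_conv_nth)
  \<comment> \<open>The power \<open>^^ 1\<close> is inserted so that \<open>cyclic_rotation\<close>
    applies.\<close>
  have "x = (cycle_of_list ?l ^^ 1) x" using eq by simp
  also have "\<dots> = map (cycle_of_list ?l ^^ 1) ?l ! i" using i by (simp only: nth_map)
  also have "\<dots> = ?l ! (Suc i mod length ?l)"
    unfolding cyclic_rotation[OF assms(1)] using i by (subst nth_rotate) (simp_all only: plus_1_eq_Suc Suc_eq_plus1)
  finally have "?l ! (Suc i mod length ?l) = ?l ! i" using i by simp
  then have "Suc i mod length ?l = i"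
    using nth_eq_iff_index_eq[OF assms(1), of "Suc i mod length ?l" i] i by (simp del: nth_Cons_Suc)
  then show False using i by (cases "Suc i = length ?l") auto
qed

text \<open>A fixed point is a block by itself, since longer cycles move all their letters. It is
  either the last block or, by induction, a block of the prefix.\<close>

lemma hat_fixed_point_decomp:
  assumes "distinct w" "x \<in> set w" "hat w x = x"
  shows "\<exists>u v. w = u @ x # v \<and> (\<forall>y\<in>set u. y < x) \<and> (v \<noteq> [] \<longrightarrow> x < hd v)"
  using assms
proof (induction w rule: length_induct)
  case (1 w)
  let ?M = "Max (set w)"
  have "w \<noteq> []" using "1.prems" by auto
  obtain u v where w: "w = u @ ?M # v" and lt: "\<forall>x\<in>set u. x < ?M"
    and h: "hat w = hat u \<circ> cycle_of_list (?M # v)"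
    using last_block_decomp[OF \<open>w \<noteq> []\<close> "1.prems"(1)] by metis
  have d: "distinct (u @ ?M # v)" using w "1.prems"(1) by simp
  show ?case
  proof (cases "x \<in> set u")
    case True
    then have "x \<notin> set (?M # v)" using d by auto
    then have "hat u x = x" using h "1.prems"(3) id_outside_supp by (metis comp_apply)
    moreover have "length u < length w" by (subst w) simp
    moreover have "distinct u" using d by auto
    ultimately obtain u1 u2 where "u = u1 @ x # u2" "\<forall>y\<in>set u1. y < x" "u2 \<noteq> [] \<longrightarrow> x < hd u2"
      using "1.IH" True by blast
    moreover from this have "w = u1 @ x # (u2 @ ?M # v)" using w by simp
    \<comment> \<open>If \<open>u2\<close> is empty, the letter after \<open>x\<close> is the
      maximum of the whole word.\<close>
    moreover have "x < hd (u2 @ ?M # v)" using calculation lt True by (cases u2) auto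
    ultimately show ?thesis by blast
  next
    case False
    then have x: "x \<in> set (?M # v)" using "1.prems"(2) w by (metis Un_iff set_append)
    then have c: "cycle_of_list (?M # v) x = x"
      using hat_eq_cycle_of_list[OF d h x] "1.prems"(3) by simp
    have "v = []"
    proof (cases v)
      case (Cons d cs)
      then show ?thesis using cycle_of_list_no_fixed_point[of ?M d cs x] c x d by auto
    qed
    then show ?thesis using x w lt by auto
  qed
qed

section \<open>Avoidance as a condition on fixed points\<close>

text \<open>For permutations of \<open>{1..n}\<close> these are the strong fixed points:
  left-to-right maxima that are also right-to-left minima.\<close>

definition splits_at :: "nat list \<Rightarrow> nat \<Rightarrow> bool" where
  "splits_at w b \<longleftrightarrow> (\<exists>u v. w = u @ b # v \<and> (\<forall>y\<in>set u. y < b) \<and> (\<forall>y\<in>set v. b < y))"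

lemma contains_31_22_iff:
  assumes "set w = {1..length w}"
  shows "contains_arrow_pattern w [3, 1] {(2, 2)} \<longleftrightarrow>
    (\<exists>p q b. p < q \<and> q < length w \<and> w ! q < b \<and> b < w ! p \<and> hat w b = b)"
proof -
  have size: "pattern_size [3, 1] {(2, 2)} = 3"
    by (simp add: pattern_size_def pattern_letters_def)
  have ivl: "{1..3::nat} = {1, 2, 3}" "{..<length [3, 1::nat]} = {0, 1}" by auto
  show ?thesis
  proof
    assume "contains_arrow_pattern w [3, 1] {(2, 2)}"
    then obtain x t where x: "strict_mono_on {1, 2, 3::nat} x" and t: "strict_mono_on {0, 1::nat} t"
      "t ` {0, 1} \<subseteq> {..<length w}"
      and eqs: "\<forall>i<length [3, 1::nat]. w ! t i = x ([3, 1] ! i)" "hat w (x 2) = x 2"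
      unfolding contains_arrow_pattern_def size ivl by auto
    have "x 1 < x 2" "x 2 < x 3" "t 0 < t 1"
      using x t(1) by (auto simp: strict_mono_on_def)
    moreover have "w ! t 0 = x 3" "w ! t 1 = x 1" using eqs(1)[rule_format, of 0] eqs(1)[rule_format, of 1] by simp_all
    ultimately show "\<exists>p q b. p < q \<and> q < length w \<and> w ! q < b \<and> b < w ! p \<and> hat w b = b"
      using t(2) eqs(2) by (intro exI[of _ "t 0"] exI[of _ "t 1"] exI[of _ "x 2"]) auto
  next
    assume "\<exists>p q b. p < q \<and> q < length w \<and> w ! q < b \<and> b < w ! p \<and> hat w b = b"
    then obtain p q b where *: "p < q" "q < length w" "w ! q < b" "b < w ! p" "hat w b = b" by blast
    \<comment> \<open>Only the arguments 1, 2, 3 of \<open>x\<close> and 0, 1 of \<open>t\<close>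
      matter, so the last branch of each serves as the value at 3 and at 1 respectively.\<close>
    define x where "x = (\<lambda>i::nat. if i = 1 then w ! q else if i = 2 then b else w ! p)"
    define t where "t = (\<lambda>i::nat. if i = 0 then p else q)"
    have "w ! p \<in> {1..length w}" "w ! q \<in> {1..length w}" using * assms by (auto simp flip: assms)
    then have "x ` {1, 2, 3} \<subseteq> {1..length w}" using * by (auto simp: x_def)
    moreover have "strict_mono_on {1, 2, 3} x" "strict_mono_on {0, 1} t"
      using * by (auto simp: strict_mono_on_def x_def t_def)
    moreover have "t ` {0, 1} \<subseteq> {..<length w}" using * by (auto simp: t_def)
    moreover have "\<forall>i<length [3, 1::nat]. w ! t i = x ([3, 1] ! i)"
      by (auto simp: x_def t_def less_Suc_eq)
    moreover have "hat w (x 2) = x 2" using * by (simp add: x_def)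
    ultimately show "contains_arrow_pattern w [3, 1] {(2, 2)}"
      unfolding contains_arrow_pattern_def size ivl by blast
  qed
qed

text \<open>Expresses avoidance one fixed point at a time, the form that passes to the two parts of
  a cut word.\<close>

lemma avoiders_31_22_eq:
  "avoiders n [3, 1] {(2, 2)} =
    {w \<in> permutations_of_set {1..n}. \<forall>b\<in>{1..n}. hat w b = b \<longrightarrow> splits_at w b}"
proof -
  have "(\<exists>p q b. p < q \<and> q < length w \<and> w ! q < b \<and> b < w ! p \<and> hat w b = b) \<longleftrightarrow>
      (\<exists>b\<in>set w. hat w b = b \<and> \<not> splits_at w b)" (is "?L \<longleftrightarrow> ?R")
    if w: "w \<in> permutations_of_set {1..n}" for w
  proof
    have set: "set w = {1..n}" and d: "distinct w" using w by (auto simp: permutations_of_set_def)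
    {
      assume ?L
      then obtain p q b where *: "p < q" "q < length w" "w ! q < b" "b < w ! p" "hat w b = b" by blast
      have "w ! p \<in> set w" "w ! q \<in> set w" using * by auto
      then have "b \<in> set w" using * set by auto
      moreover have "\<not> splits_at w b"
      proof
        assume "splits_at w b"
        then obtain u v where uv: "w = u @ b # v" "\<forall>y\<in>set u. y < b" "\<forall>y\<in>set v. b < y"
          unfolding splits_at_def by blast
        \<comment> \<open>The letter at \<open>q\<close> is below \<open>b\<close>, so
          \<open>q\<close> lies in \<open>u\<close>; then so does \<open>p\<close>, whose letter is
          too large for \<open>u\<close>.\<close>
        have "q < length u"
        proof (rule ccontr)
          assume "\<not> q < length u"
          then have "w ! q \<in> set (b # v)"
            using * uv(1) by (simp only: nth_append if_False) (intro nth_mem, simp)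
          then show False using uv(3) *(3) by auto
        qed
        then have "w ! p \<in> set u" using *(1) uv(1) by (simp add: nth_append)
        then show False using uv(2) *(4) by auto
      qed
      ultimately show ?R using *(5) by blast
    next
      assume ?R
      then obtain b where b: "b \<in> set w" "hat w b = b" "\<not> splits_at w b" by blast
      obtain u v where uv: "w = u @ b # v" "\<forall>y\<in>set u. y < b" "v \<noteq> [] \<longrightarrow> b < hd v"
        using hat_fixed_point_decomp[OF d b(1,2)] by blast
      obtain y where y: "y \<in> set v" "\<not> b < y" using b(3) uv unfolding splits_at_def by blast
      then have "y < b" using d uv(1) by (metis distinct.simps(2) distinct_append linorder_neqE_nat)
      obtain i where i: "i < length v" "v ! i = y" using y(1) by (metis in_set_conv_nth)
      have "v \<noteq> []" using y by auto
      have "b < v ! 0" using uv(3) \<open>v \<noteq> []\<close> by (simp add: hd_conv_nth)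
      then have "i \<noteq> 0" using i \<open>y < b\<close> by (metis less_asym)
      \<comment> \<open>The letter right after \<open>b\<close> plays the 3 and \<open>y\<close>
        plays the 1; \<open>i \<noteq> 0\<close> puts them in this order.\<close>
      let ?p = "Suc (length u)" and ?q = "Suc (length u) + i"
      have "w ! ?p = v ! 0" "w ! ?q = v ! i" unfolding uv(1) by (simp_all add: nth_append)
      then show ?L
        using \<open>i \<noteq> 0\<close> \<open>b < v ! 0\<close> i \<open>y < b\<close> b(2) uv(1)
        by (intro exI[of _ ?p] exI[of _ ?q] exI[of _ b]) simp
    }
  qed
  moreover have set: "set w = {1..n}" "set w = {1..length w}" if "w \<in> permutations_of_set {1..n}" for w
    using that length_finite_permutations_of_set[OF that] by (auto simp: permutations_of_set_def)
  ultimately have "\<not> contains_arrow_pattern w [3, 1] {(2, 2)} \<longleftrightarrow>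
      (\<forall>b\<in>{1..n}. hat w b = b \<longrightarrow> splits_at w b)" if "w \<in> permutations_of_set {1..n}" for w
    unfolding contains_31_22_iff[OF set(2)[OF that]]
    using that by metis
  then show ?thesis unfolding avoiders_def by (intro Collect_cong conj_cong refl)
qed

section \<open>Cutting at the largest fixed point, and the recurrence\<close>

text \<open>When \<open>m\<close> splits the word, \<open>hat u\<close> and \<open>hat v\<close> act
  on disjoint sets of values. Avoidance below \<open>m\<close> then concerns \<open>u\<close> alone,
  and the absence of fixed points above \<open>m\<close> concerns \<open>v\<close> alone.\<close>

lemma avoiders_decomp:
  assumes "m \<in> {1..n}"
  shows "bij_betw (\<lambda>(u, v). u @ m # v)
    (avoiders (m - 1) [3, 1] {(2, 2)} \<times> hat_derangements {m<..n})
    {w \<in> avoiders n [3, 1] {(2, 2)}. hat w m = m \<and> (\<forall>x\<in>{m<..n}. hat w x \<noteq> x)}"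
    (is "bij_betw ?f (?U \<times> ?V) ?W")
proof -
  \<comment> \<open>Stated for a word already cut at \<open>m\<close>, this equivalence yields both
    inclusions for the image.\<close>
  have split: "w \<in> ?W \<longleftrightarrow> u \<in> ?U \<and> v \<in> ?V"
    if w: "w = u @ m # v" and lt: "\<forall>y\<in>set u. y < m" and gt: "\<forall>y\<in>set v. m < y" for u v w
  proof -
    have hat: "hat w = hat u \<circ> hat v"
    proof -
      \<comment> \<open>\<open>hat_append\<close> applies at both cuts, and the block
        \<open>[m]\<close> contributes the identity.\<close>
      have "hat (u @ [m] @ v) = hat u \<circ> (hat [m] \<circ> hat v)"
        using lt gt by (subst hat_append, simp, subst hat_append) auto
      then show ?thesis using w by simp
    qed
    have perm: "w \<in> permutations_of_set {1..n} \<longleftrightarrow>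
      u \<in> permutations_of_set {1..m - 1} \<and> v \<in> permutations_of_set {m<..n}"
    proof -
      have "set w = {1..n} \<longleftrightarrow> set u = {1..m - 1} \<and> set v = {m<..n}" (is "?l \<longleftrightarrow> ?r")
      proof
        assume l: ?l
        have "set u = {x \<in> set w. x < m}" "set v = {x \<in> set w. m < x}" using w lt gt by auto
        then show ?r using l assms by auto
      next
        assume ?r
        then show ?l using w assms by auto
      qed
      moreover have "distinct w \<longleftrightarrow> distinct u \<and> distinct v" using w lt gt by fastforce
      ultimately show ?thesis by (auto simp: permutations_of_set_def)
    qed
    show ?thesis
    proof (cases "w \<in> permutations_of_set {1..n}")
      case False
      then show ?thesis using perm unfolding avoiders_31_22_eq hat_derangements_def by blast
    next
      case True
      then have u: "set u = {1..m - 1}" "distinct u" and v: "set v = {m<..n}" "distinct v"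
        and set: "set w = {1..n}" and d: "distinct w"
        using perm by (auto simp: permutations_of_set_def)
      have hu: "hat w x = hat u x" if "x \<le> m" for x
        using that v permutes_not_in[OF hat_permutes[OF v(2)], of x] by (simp add: hat)
      have hv: "hat w x = hat v x" if "m < x" for x
      proof -
        have "hat v x \<notin> set u"
        proof (cases "x \<in> set v")
          case True
          then have "hat v x \<in> set v" using permutes_in_image[OF hat_permutes[OF v(2)]] by blast
          then show ?thesis using u v by auto
        next
          case False
          then show ?thesis using that u permutes_not_in[OF hat_permutes[OF v(2)]] by auto
        qed
        then show ?thesis by (simp add: hat permutes_not_in[OF hat_permutes[OF u(2)]])
      qed
      have hm: "hat w m = m"
        using hu[of m] u assms permutes_not_in[OF hat_permutes[OF u(2)], of m] by auto
      have sm: "splits_at w m" using w lt gt unfolding splits_at_def by blast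
      \<comment> \<open>The letters of \<open>w\<close> behind \<open>u\<close> all exceed
        \<open>b\<close>. As \<open>b\<close> occurs only once, the factorization around it is
        unique.\<close>
      have su: "splits_at w b \<longleftrightarrow> splits_at u b" if b: "b \<in> set u" for b
      proof -
        obtain u1 u2 where u12: "u = u1 @ b # u2" using b by (meson split_list)
        have w12: "w = u1 @ b # (u2 @ m # v)" using u12 w by simp
        have bn: "b \<notin> set u1" "b \<notin> set u2" "b \<notin> set (u2 @ m # v)" using d w12 by auto
        have "splits_at u b \<longleftrightarrow> (\<forall>y\<in>set u1. y < b) \<and> (\<forall>y\<in>set u2. b < y)"
          unfolding splits_at_def u12 append_Cons_eq_iff[OF bn(1,2)] by blast
        moreover have "splits_at w b \<longleftrightarrow> (\<forall>y\<in>set u1. y < b) \<and> (\<forall>y\<in>set (u2 @ m # v). b < y)"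
          unfolding splits_at_def w12 append_Cons_eq_iff[OF bn(1,3)] by blast
        moreover have "\<forall>y\<in>set (m # v). b < y" using b lt gt by force
        ultimately show ?thesis by auto
      qed
      have ivl: "{1..n} = {1..m - 1} \<union> {m} \<union> {m<..n}" using assms by auto
      have le: "b \<le> m" if "b \<in> {1..m - 1}" for b using that by auto
      have "w \<in> ?W \<longleftrightarrow> (\<forall>b\<in>{1..n}. hat w b = b \<longrightarrow> splits_at w b) \<and> (\<forall>x\<in>{m<..n}. hat w x \<noteq> x)"
        unfolding avoiders_31_22_eq using True hm by blast
      also have "\<dots> \<longleftrightarrow> (\<forall>b\<in>{1..m - 1}. hat w b = b \<longrightarrow> splits_at w b) \<and> (\<forall>x\<in>{m<..n}. hat w x \<noteq> x)"
        unfolding ivl using sm by blast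
      also have "\<dots> \<longleftrightarrow> (\<forall>b\<in>{1..m - 1}. hat u b = b \<longrightarrow> splits_at u b) \<and> (\<forall>x\<in>{m<..n}. hat v x \<noteq> x)"
        using hu[OF le] hv su u(1) by auto
      also have "\<dots> \<longleftrightarrow> u \<in> ?U \<and> v \<in> ?V"
        unfolding avoiders_31_22_eq hat_derangements_def using True perm by blast
      finally show ?thesis .
    qed
  qed
  have bounds: "(\<forall>y\<in>set u. y < m) \<and> (\<forall>y\<in>set v. m < y)" if "u \<in> ?U" "v \<in> ?V" for u v
    using that assms unfolding avoiders_31_22_eq hat_derangements_def
    by (auto simp: permutations_of_set_def)
  have "inj_on ?f (?U \<times> ?V)"
  proof (rule inj_onI, clarify)
    fix u v u' v' assume *: "u \<in> ?U" "v \<in> ?V" "u' \<in> ?U" "v' \<in> ?V" "u @ m # v = u' @ m # v'"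
    have "m \<notin> set u" "m \<notin> set v" using bounds[OF *(1,2)] by auto
    then show "u = u' \<and> v = v'" using *(5) by (simp add: append_Cons_eq_iff)
  qed
  moreover have "?f ` (?U \<times> ?V) = ?W"
  proof
    show "?f ` (?U \<times> ?V) \<subseteq> ?W"
    proof
      fix w assume "w \<in> ?f ` (?U \<times> ?V)"
      then obtain u v where uv: "w = u @ m # v" "u \<in> ?U" "v \<in> ?V" unfolding image_iff by force
      show "w \<in> ?W" by (subst split[OF uv(1)]) (use uv bounds in blast)+
    qed
    show "?W \<subseteq> ?f ` (?U \<times> ?V)"
    proof
      fix w assume w: "w \<in> ?W"
      then have "splits_at w m" using assms unfolding avoiders_31_22_eq by blast
      then obtain u v where "w = u @ m # v" "\<forall>y\<in>set u. y < m" "\<forall>y\<in>set v. m < y"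
        unfolding splits_at_def by blast
      then have "w = u @ m # v" "u \<in> ?U \<and> v \<in> ?V" using split w by blast+
      then show "w \<in> ?f ` (?U \<times> ?V)" by (intro image_eqI[of _ _ "(u, v)"]) simp_all
    qed
  qed
  ultimately show ?thesis by (simp add: bij_betw_def)
qed

text \<open>Avoiders are sorted by their largest fixed point \<open>m\<close>, those without any
  giving the first term. The case \<open>n = 0\<close> is included.\<close>

lemma card_avoiders_rec:
  "card (avoiders n [3, 1] {(2, 2)}) = derangement_number n
    + (\<Sum>m = 1..n. derangement_number (n - m) * card (avoiders (m - 1) [3, 1] {(2, 2)}))"
proof -
  let ?A = "avoiders n [3, 1] {(2, 2)}"
  define W where "W m = {w \<in> ?A. hat w m = m \<and> (\<forall>x\<in>{m<..n}. hat w x \<noteq> x)}" for m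
  have fin: "finite ?A" by (simp add: avoiders_def)
  have cardW: "card (W m) = derangement_number (n - m) * card (avoiders (m - 1) [3, 1] {(2, 2)})"
    if "m \<in> {1..n}" for m
    using bij_betw_same_card[OF avoiders_decomp[OF that]]
    unfolding W_def by (simp add: card_cartesian_product card_hat_derangements mult.commute)
  have "?A = hat_derangements {1..n} \<union> (\<Union>m\<in>{1..n}. W m)"
  proof
    \<comment> \<open>Without fixed points the condition for avoidance is vacuous.\<close>
    show "hat_derangements {1..n} \<union> (\<Union>m\<in>{1..n}. W m) \<subseteq> ?A"
      unfolding W_def hat_derangements_def avoiders_31_22_eq by auto
    show "?A \<subseteq> hat_derangements {1..n} \<union> (\<Union>m\<in>{1..n}. W m)"
    proof
      fix w assume w: "w \<in> ?A"
      let ?F = "{i \<in> {1..n}. hat w i = i}"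
      show "w \<in> hat_derangements {1..n} \<union> (\<Union>m\<in>{1..n}. W m)"
      proof (cases "?F = {}")
        case True
        then show ?thesis using w by (auto simp: hat_derangements_def avoiders_def)
      next
        case False
        have fF: "finite ?F" by simp
        define M where "M = Max ?F"
        have "M \<in> ?F" unfolding M_def using Max_in[OF fF False] .
        moreover have "hat w x \<noteq> x" if "x \<in> {M<..n}" for x
        proof
          assume "hat w x = x"
          then have "x \<in> ?F" using that by auto
          then have "x \<le> M" unfolding M_def by (rule Max_ge[OF fF])
          then show False using that by simp
        qed
        ultimately have "w \<in> W M" "M \<in> {1..n}" using w by (auto simp: W_def)
        then show ?thesis by blast
      qed
    qed
  qed
  moreover have "hat_derangements {1..n} \<inter> (\<Union>m\<in>{1..n}. W m) = {}"
    by (auto simp: W_def hat_derangements_def)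
  \<comment> \<open>The larger index would be a fixed point above the smaller one.\<close>
  moreover have disj: "W i \<inter> W j = {}" if "i \<in> {1..n}" "j \<in> {1..n}" "i \<noteq> j" for i j
    using that by (cases i j rule: linorder_cases) (auto simp: W_def)
  moreover have "finite (hat_derangements {1..n})" by (simp add: hat_derangements_def)
  moreover have finW: "finite (W m)" for m using fin by (simp add: W_def)
  ultimately have "card ?A = card (hat_derangements {1..n}) + card (\<Union>m\<in>{1..n}. W m)"
    by (metis card_Un_disjoint finite_UN_I finite_atLeastAtMost)
  also have "card (\<Union>m\<in>{1..n}. W m) = (\<Sum>m = 1..n. card (W m))"
    using finW disj by (intro card_UN_disjoint) auto
  also have "\<dots> = (\<Sum>m = 1..n. derangement_number (n - m) * card (avoiders (m - 1) [3, 1] {(2, 2)}))"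
    by (rule sum.cong[OF refl cardW])
  finally show ?thesis by (simp add: card_hat_derangements)
qed

theorem theorem4p5:
  fixes a :: "nat \<Rightarrow> nat" and n :: nat
  assumes a_0: "a 0 = 1"
    and a_pos: "\<And>j. j \<ge> 1 \<Longrightarrow> a j = card (avoiders j [3, 1] {(2, 2)})"
    and n: "n \<ge> 1"
  shows "a n = derangement_number n
           + (\<Sum>m = 1..n. derangement_number (n - m) * a (m - 1))"
proof -
  have "a j = card (avoiders j [3, 1] {(2, 2)})" for j
  proof (cases "j = 0")
    case True
    \<comment> \<open>The convention \<open>a 0 = 1\<close> agrees with the count, as the empty word
      avoids the pattern.\<close>
    have "avoiders 0 [3, 1] {(2, 2)} = {[]}" unfolding avoiders_31_22_eq by auto
    then show ?thesis using True a_0 by simp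
  qed (simp add: a_pos)
  then show ?thesis by (simp only: card_avoiders_rec[of n, symmetric])
qed

end
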